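(* Consider the opinion dynamics on $\mathbb{R}^{N_a}$ $$\dot x_i = -d\,x_i + u\,S\Big(\alpha x_i + \gamma \sum_{k=1,\,k\neq i}^{N_a} \bar a_{ik} x_k\Big),\qquad i=1,\dots,N_a,$$ with $d>0$, $\alpha\ge 0$, $u\ge 0$, and $\bar A=(\bar a_{ik})$ the $0/1$ adjacency matrix of an undirected, connected graph $\bar G$ with vertex set $V=\{1,\dots,N_a\}$. Let $\Gamma$ be the automorphism group of $\bar G$, and for $i,k\in V$ write $i\sim k$ if $k=\rho i$ for some $\rho\in\Gamma$. Let $\lambda_{max},\lambda_{min}$ be the largest and smallest eigenvalues of $\bar A$. **A.** Suppose $\gamma>0$. For the agreement equilibria $\mathbf{x}=(x_1,\dots,x_{N_a})$ that emerge from $\mathbf{x}=\mathbf{0}$ in the steady-state bifurcation at $u=u_a:=\frac{d}{\alpha+\gamma\lambda_{max}}$ along the $\lambda_{max}$-eigenspace of $\bar A$: if $i\sim k$, then $x_i=x_k$. **B.** Suppose $\gamma<0$ and $\lambda_{min}$ has multiplicity $1$. For the disagreement equilibria $\mathbf{x}=(x_1,\dots,x_{N_a})$ that emerge from $\mathbf{x}=\mathbf{0}$ in the steady-state bifurcation at $u=u_d:=\frac{d}{\alpha+\gamma\lambda_{min}}$ along the $\lambda_{min}$-eigenspace of $\bar A$: if $i\sim k$, then $|x_i|=|x_k|$.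
   Context: Standing assumptions: $N_a\ge 2$; the graph has no self-loops; $\bar a_{ik}\in\{0,1\}$ with $\bar a_{ik}=1$ iff $(i,k)$ is an edge, so $\bar A$ is symmetric. $S:\mathbb{R}\to\mathbb{R}$ is an odd, saturating (bounded), twice continuously differentiable function with $S(0)=0$, $S'(0)=1$, and $\operatorname{sign}(S''(z))=-\operatorname{sign}(z)$ for all $z$. A graph automorphism is a permutation of the vertices mapping edges to edges and non-edges to non-edges. For $\gamma>0$, at $u=u_a$ branches of nonzero equilibria emerge from $\mathbf{x}=\mathbf{0}$ along (tangent to) the $\lambda_{max}$-eigenspace of $\bar A$; they are agreement equilibria ($x_i\ne0$ and $\operatorname{sign}(x_i)=\operatorname{sign}(x_k)$ for all $i,k\in V$). For $\gamma<0$, at $u=u_d$ branches of nonzero equilibria emerge from $\mathbf{x}=\mathbf{0}$ along (tangent to) the $\lambda_{min}$-eigenspace of $\bar A$; they are disagreement equilibria ($\operatorname{sign}(x_i)=-\operatorname{sign}(x_k)\ne0$ for at least one pair $i,k$). The statement concerns equilibria on these branches with $(\mathbf{x},u)$ sufficiently close to the bifurcation point $(\mathbf{0},u_a)$, respectively $(\mathbf{0},u_d)$. *)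

theory Defs
  imports "HOL-Analysis.Analysis"
begin

definition simple_graph :: "('n \<Rightarrow> 'n \<Rightarrow> bool) \<Rightarrow> bool" where
  "simple_graph E \<longleftrightarrow> (\<forall>i k. E i k \<longrightarrow> E k i) \<and> (\<forall>i. \<not> E i i)"

definition connected_graph :: "('n \<Rightarrow> 'n \<Rightarrow> bool) \<Rightarrow> bool" where
  "connected_graph E \<longleftrightarrow> (\<forall>i k. E\<^sup>*\<^sup>* i k)"

definition adjacency :: "('n::finite \<Rightarrow> 'n \<Rightarrow> bool) \<Rightarrow> real^'n^'n" where
  "adjacency E = (\<chi> i k. if E i k then 1 else 0)"

definition automorphisms :: "('n \<Rightarrow> 'n \<Rightarrow> bool) \<Rightarrow> ('n \<Rightarrow> 'n) set" where
  "automorphisms E = {\<rho>. bij \<rho> \<and> (\<forall>i k. E (\<rho> i) (\<rho> k) \<longleftrightarrow> E i k)}"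

definition same_orbit :: "('n \<Rightarrow> 'n \<Rightarrow> bool) \<Rightarrow> 'n \<Rightarrow> 'n \<Rightarrow> bool" where
  "same_orbit E i k \<longleftrightarrow> (\<exists>\<rho>\<in>automorphisms E. k = \<rho> i)"

definition eigenspace :: "real^'n^'n \<Rightarrow> real \<Rightarrow> (real^'n) set" where
  "eigenspace A l = {v. A *v v = l *\<^sub>R v}"

definition eigenvalues :: "real^'n^'n \<Rightarrow> real set" where
  "eigenvalues A = {l. \<exists>v. v \<noteq> 0 \<and> v \<in> eigenspace A l}"

definition lambda_max :: "real^'n^'n \<Rightarrow> real" where
  "lambda_max A = Max (eigenvalues A)"

definition lambda_min :: "real^'n^'n \<Rightarrow> real" where
  "lambda_min A = Min (eigenvalues A)"

text \<open>Only used for symmetric matrices, where geometric and algebraic multiplicity coincide.\<close>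

definition eigen_multiplicity :: "real^'n^'n \<Rightarrow> real \<Rightarrow> nat" where
  "eigen_multiplicity A l = dim (eigenspace A l)"

definition saturating :: "(real \<Rightarrow> real) \<Rightarrow> bool" where
  "saturating S \<longleftrightarrow>
     (\<forall>z. S (- z) = - S z) \<and> bounded (range S) \<and>
     (\<forall>z. S field_differentiable at z) \<and>
     (\<forall>z. deriv S field_differentiable at z) \<and>
     continuous_on UNIV (deriv (deriv S)) \<and>
     S 0 = 0 \<and> deriv S 0 = 1 \<and>
     (\<forall>z. sgn (deriv (deriv S) z) = - sgn z)"

definition opinion_field ::
  "real \<Rightarrow> real \<Rightarrow> real \<Rightarrow> (real \<Rightarrow> real) \<Rightarrow> real^'n^'n \<Rightarrow> real \<Rightarrow> real^'n \<Rightarrow> real^'n" where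
  "opinion_field d \<alpha> \<gamma> S A u x =
     (\<chi> i. - d * x $ i + u * S (\<alpha> * x $ i + \<gamma> * (\<Sum>k\<in>UNIV - {i}. A $ i $ k * x $ k)))"

definition equilibrium ::
  "real \<Rightarrow> real \<Rightarrow> real \<Rightarrow> (real \<Rightarrow> real) \<Rightarrow> real^'n^'n \<Rightarrow> real \<Rightarrow> real^'n \<Rightarrow> bool" where
  "equilibrium d \<alpha> \<gamma> S A u x \<longleftrightarrow> opinion_field d \<alpha> \<gamma> S A u x = 0"

definition agreement :: "real^'n \<Rightarrow> bool" where
  "agreement x \<longleftrightarrow> (\<forall>i k. x $ i \<noteq> 0 \<and> sgn (x $ i) = sgn (x $ k))"

definition disagreement :: "real^'n \<Rightarrow> bool" where
  "disagreement x \<longleftrightarrow> (\<exists>i k. sgn (x $ i) = - sgn (x $ k) \<and> sgn (x $ k) \<noteq> 0)"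

text \<open>
  A branch is a continuous curve of pairs (opinion vector, attention u) starting at the
  bifurcation point and consisting of nonzero equilibria afterwards. Tangency to the subspace W is
  stated independently of the parametrization: the directions of the opinion vectors converge
  to a (necessarily unit) vector of W.
\<close>

definition emerging_branch ::
  "real \<Rightarrow> real \<Rightarrow> real \<Rightarrow> (real \<Rightarrow> real) \<Rightarrow> real^'n^'n \<Rightarrow> real \<Rightarrow> (real^'n) set
     \<Rightarrow> (real \<Rightarrow> (real^'n) \<times> real) \<Rightarrow> bool" where
  "emerging_branch d \<alpha> \<gamma> S A u0 W p \<longleftrightarrow>
     path p \<and> pathstart p = (0, u0) \<and>
     (\<forall>s\<in>{0<..1}. fst (p s) \<noteq> 0 \<and> snd (p s) \<ge> 0 \<and>
        equilibrium d \<alpha> \<gamma> S A (snd (p s)) (fst (p s))) \<and>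
     (\<exists>v\<in>W. ((\<lambda>s. fst (p s) /\<^sub>R norm (fst (p s))) \<longlongrightarrow> v) (at_right 0))"

end

theory Submission
  imports Defs
begin

text \<open>
  If \<open>x\<close> is an equilibrium and \<open>\<rho>\<close> an automorphism, then \<open>x \<circ> \<rho>\<close> is an equilibrium for the same
  \<open>u\<close>, so both parts reduce to a uniqueness statement.

  For \<open>\<gamma> > 0\<close>, the positive equilibria are fixed points of a monotone map that is strictly
  subhomogeneous because \<open>S\<close> is strictly concave on the positive axis. Such a map has at most one
  positive fixed point: given two, \<open>x\<close> and \<open>y\<close>, take the largest \<open>t\<close> with \<open>t y \<le> x\<close>; if \<open>t < 1\<close>,
  then at a coordinate where \<open>t y\<close> and \<open>x\<close> touch, the image of \<open>t y\<close> strictly exceeds that of \<open>x\<close>,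
  contradicting monotonicity. Hence \<open>y \<le> x\<close>, and \<open>x \<le> y\<close> by symmetry.

  For \<open>\<gamma> < 0\<close>, let \<open>v\<close> span the eigenspace. The linearisation at the bifurcation point is injective
  on the orthogonal complement of \<open>v\<close>, so two equilibria near it with the same \<open>u\<close> and the same
  component along \<open>v\<close> coincide. Since \<open>v \<circ> \<rho>\<close> is \<open>v\<close> or \<open>- v\<close>, this applies to \<open>x \<circ> \<rho>\<close> and \<open>x\<close>
  or \<open>- x\<close>.
\<close>

section \<open>Real functions\<close>

lemma le_tangent_if_antimono_deriv:
  fixes f f' :: "real \<Rightarrow> real"
  assumes deriv: "\<And>x. \<lbrakk>b \<le> x; x \<le> c\<rbrakk> \<Longrightarrow> (f has_real_derivative f' x) (at x)"
    and antimono: "antimono_on {b..c} f'"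
    and "b \<le> c"
  shows "f c \<le> f b + (c - b) * f' b"
proof (cases "b = c")
  case False
  then have "b < c" using \<open>b \<le> c\<close> by simp
  then obtain \<xi> where \<xi>: "b < \<xi>" "\<xi> < c" "f c - f b = (c - b) * f' \<xi>"
    using MVT2[OF \<open>b < c\<close>, of f f'] deriv by blast
  then have "f' \<xi> \<le> f' b"
    by (intro monotone_onD[OF antimono]) auto
  then have "(c - b) * f' \<xi> \<le> (c - b) * f' b"
    using \<open>b < c\<close> by simp
  then show ?thesis using \<xi>(3) by linarith
qed simp

lemma deriv_pos_if_strict_antimono_bdd_below:
  fixes f f' :: "real \<Rightarrow> real"
  assumes deriv: "\<And>x. a \<le> x \<Longrightarrow> (f has_real_derivative f' x) (at x)"
    and antimono: "strict_antimono_on {a..} f'"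
    and bdd: "bdd_below (f ` {a..})"
    and "a \<le> z"
  shows "0 < f' z"
proof (rule ccontr)
  assume "\<not> 0 < f' z"
  obtain m where lower_bound: "\<And>x. a \<le> x \<Longrightarrow> m \<le> f x"
    using bdd by (auto simp: bdd_below_def)
  define b where "b = z + 1"
  have "f' b < f' z"
    using \<open>a \<le> z\<close> by (intro monotone_onD[OF antimono]) (auto simp: b_def)
  then have slope: "f' b < 0" using \<open>\<not> 0 < f' z\<close> by linarith
  \<comment> \<open>The tangent at \<open>b\<close> takes the value \<open>m - 1\<close> at \<open>c\<close>.\<close>
  define c where "c = b + (m - 1 - f b) / f' b"
  have "m \<le> f b" using \<open>a \<le> z\<close> by (intro lower_bound) (simp add: b_def)
  then have "b \<le> c" using slope by (simp add: c_def divide_nonpos_neg)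
  moreover have "antimono_on {b..c} f'"
    using antimono[unfolded strict_antimono_iff_antimono] \<open>a \<le> z\<close>
    by (auto simp: b_def intro: monotone_on_subset)
  ultimately have "f c \<le> f b + (c - b) * f' b"
    using deriv \<open>a \<le> z\<close> by (intro le_tangent_if_antimono_deriv) (auto simp: b_def)
  also have "\<dots> = m - 1" using slope by (simp add: c_def)
  finally show False
    using lower_bound[of c] \<open>a \<le> z\<close> \<open>b \<le> c\<close> by (simp add: b_def)
qed

lemma strictly_subhomogeneous_if_strict_antimono_deriv:
  fixes f f' :: "real \<Rightarrow> real"
  assumes deriv: "\<And>x. 0 \<le> x \<Longrightarrow> (f has_real_derivative f' x) (at x)"
    and antimono: "strict_antimono_on {0..} f'"
    and "0 \<le> f 0" "0 < t" "t < 1" "0 < z"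
  shows "t * f z < f (t * z)"
proof -
  have tz: "0 < t * z" "t * z < z" using assms by auto
  obtain \<xi> where \<xi>: "0 < \<xi>" "\<xi> < t * z" "f (t * z) - f 0 = (t * z - 0) * f' \<xi>"
    using MVT2[OF tz(1), of f f'] deriv by blast
  obtain \<zeta> where \<zeta>: "t * z < \<zeta>" "\<zeta> < z" "f z - f (t * z) = (z - t * z) * f' \<zeta>"
    using MVT2[OF tz(2), of f f'] deriv tz(1) by force
  have "f' \<zeta> < f' \<xi>"
    using \<xi> \<zeta> by (intro monotone_onD[OF antimono]) auto
  then have "0 < (1 - t) * (t * z) * (f' \<xi> - f' \<zeta>)"
    using assms by simp
  also have "\<dots> = (1 - t) * (f (t * z) - f 0) - t * (f z - f (t * z))"
    unfolding \<xi>(3) \<zeta>(3) by (simp add: algebra_simps)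
  also have "\<dots> = f (t * z) - t * f z - (1 - t) * f 0"
    by (simp add: algebra_simps)
  also have "\<dots> \<le> f (t * z) - t * f z"
    using \<open>0 \<le> f 0\<close> \<open>t < 1\<close> by simp
  finally show ?thesis by simp
qed

lemma strict_mono_if_odd_strict_mono_on_nonneg:
  fixes f :: "'a::linordered_ab_group_add \<Rightarrow> 'b::linordered_ab_group_add"
  assumes odd: "\<And>x. f (- x) = - f x" and mono: "strict_mono_on {0..} f"
  shows "strict_mono f"
proof (rule strict_monoI)
  have "f 0 = 0" using odd[of 0] by simp
  fix x y :: 'a assume "x < y"
  consider (nonneg) "0 \<le> x" | (nonpos) "y \<le> 0" | (sign_change) "x < 0" "0 < y" by force
  then show "f x < f y"
  proof cases
    case nonneg
    then show ?thesis using \<open>x < y\<close> by (intro monotone_onD[OF mono]) auto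
  next
    case nonpos
    then have "f (- y) < f (- x)"
      using \<open>x < y\<close> by (intro monotone_onD[OF mono]) auto
    then show ?thesis by (simp add: odd)
  next
    case sign_change
    then have "f 0 < f (- x)" "f 0 < f y"
      by (auto intro!: monotone_onD[OF mono])
    then have "f x < 0" "0 < f y" by (simp_all add: odd \<open>f 0 = 0\<close>)
    then show ?thesis by (rule less_trans)
  qed
qed

lemma continuous_deriv_imp_strict_deriv:
  fixes f f' :: "'a::real_normed_field \<Rightarrow> 'a"
  assumes deriv: "\<forall>\<^sub>F z in nhds c. (f has_field_derivative f' z) (at z)"
    and "isCont f' c" and "0 < \<eta>"
  obtains \<delta> where "0 < \<delta>"
    "\<And>a b. \<lbrakk>a \<in> ball c \<delta>; b \<in> ball c \<delta>\<rbrakk> \<Longrightarrow> norm (f a - f b - f' c * (a - b)) \<le> \<eta> * norm (a - b)"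
proof -
  have "(f' \<longlongrightarrow> f' c) (nhds c)"
    using \<open>isCont f' c\<close> by (simp add: isCont_def tendsto_at_iff_tendsto_nhds)
  then have "\<forall>\<^sub>F z in nhds c. dist (f' z) (f' c) < \<eta>"
    using \<open>0 < \<eta>\<close> by (rule tendstoD)
  from eventually_conj[OF deriv this] obtain \<delta> where "0 < \<delta>"
    and near: "\<And>z. dist z c < \<delta> \<Longrightarrow> (f has_field_derivative f' z) (at z) \<and> dist (f' z) (f' c) < \<eta>"
    unfolding eventually_nhds_metric by blast
  show thesis
  proof
    fix a b assume ab: "a \<in> ball c \<delta>" "b \<in> ball c \<delta>"
    have "norm ((f a - f' c * a) - (f b - f' c * b)) \<le> \<eta> * norm (a - b)"
    proof (rule field_differentiable_bound[OF convex_ball _ _ ab])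
      fix z assume "z \<in> ball c \<delta>"
      then have z: "(f has_field_derivative f' z) (at z)" "dist (f' z) (f' c) < \<eta>"
        using near[of z] by (simp_all add: dist_commute)
      show "((\<lambda>z. f z - f' c * z) has_field_derivative f' z - f' c) (at z within ball c \<delta>)"
        by (rule derivative_eq_intros has_field_derivative_at_within[OF z(1)] refl | simp)+
      show "norm (f' z - f' c) \<le> \<eta>" using z(2) by (simp add: dist_norm)
    qed
    then show "norm (f a - f b - f' c * (a - b)) \<le> \<eta> * norm (a - b)"
      by (simp add: algebra_simps)
  qed fact
qed

section \<open>Saturating functions\<close>

lemma saturating_odd: "saturating S \<Longrightarrow> S (- z) = - S z"
  by (simp add: saturating_def)

lemma saturating_has_derivative:
  "saturating S \<Longrightarrow> (S has_real_derivative deriv S z) (at z)"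
  by (simp add: saturating_def DERIV_deriv_iff_field_differentiable)

lemma saturating_has_second_derivative:
  "saturating S \<Longrightarrow> (deriv S has_real_derivative deriv (deriv S) z) (at z)"
  by (simp add: saturating_def DERIV_deriv_iff_field_differentiable)

lemma saturating_deriv_strict_antimono:
  assumes S: "saturating S"
  shows "strict_antimono_on {0..} (deriv S)"
proof (rule monotone_onI)
  fix a b :: real assume "a \<in> {0..}" "a < b"
  show "deriv S b < deriv S a"
  proof (rule DERIV_neg_imp_decreasing_open[OF \<open>a < b\<close>])
    fix z assume "a < z"
    have "sgn (deriv (deriv S) z) = - sgn z"
      using S by (simp add: saturating_def)
    then have "deriv (deriv S) z < 0"
      using \<open>a < z\<close> \<open>a \<in> {0..}\<close> by (simp add: sgn_if split: if_splits)
    then show "\<exists>y. (deriv S has_real_derivative y) (at z) \<and> y < 0"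
      using saturating_has_second_derivative[OF S] by blast
  qed (meson saturating_has_second_derivative[OF S] DERIV_atLeastAtMost_imp_continuous_on)
qed

lemma saturating_strict_mono:
  assumes S: "saturating S"
  shows "strict_mono S"
proof (rule strict_mono_if_odd_strict_mono_on_nonneg)
  show "S (- x) = - S x" for x using S by (rule saturating_odd)
next
  have "bdd_below (S ` {0..})"
    using S by (meson bounded_imp_bdd_below bounded_subset image_mono saturating_def subset_UNIV)
  then have deriv_pos: "0 < deriv S z" if "0 \<le> z" for z
    using deriv_pos_if_strict_antimono_bdd_below[OF saturating_has_derivative[OF S]
        saturating_deriv_strict_antimono[OF S]] that by simp
  show "strict_mono_on {0..} S"
  proof (rule monotone_onI)
    fix a b :: real assume "a \<in> {0..}" "a < b"
    then have "\<exists>y. (S has_real_derivative y) (at z) \<and> 0 < y" if "a \<le> z" for z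
      using saturating_has_derivative[OF S] deriv_pos[of z] that by auto
    then show "S a < S b"
      using \<open>a < b\<close> by (rule DERIV_pos_imp_increasing[rotated])
  qed
qed

lemma saturating_pos_iff:
  assumes "saturating S"
  shows "0 < S z \<longleftrightarrow> 0 < z"
  using strict_mono_less[OF saturating_strict_mono[OF assms], of 0 z] assms
  by (simp add: saturating_def)

lemma saturating_strictly_subhomogeneous:
  assumes "saturating S" "0 < t" "t < 1" "0 < z"
  shows "t * S z < S (t * z)"
proof (rule strictly_subhomogeneous_if_strict_antimono_deriv)
  show "0 \<le> S 0" using assms(1) by (simp add: saturating_def)
qed (use assms saturating_has_derivative saturating_deriv_strict_antimono in auto)

lemma saturating_near_identity:
  assumes S: "saturating S" and "0 < \<eta>"
  obtains \<delta> where "0 < \<delta>"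
    "\<And>a b. \<lbrakk>\<bar>a\<bar> < \<delta>; \<bar>b\<bar> < \<delta>\<rbrakk> \<Longrightarrow> \<bar>S a - S b - (a - b)\<bar> \<le> \<eta> * \<bar>a - b\<bar>"
proof -
  have "isCont (deriv S) 0"
    using saturating_has_second_derivative[OF S] by (rule DERIV_isCont)
  moreover have "deriv S 0 = 1" using S by (simp add: saturating_def)
  ultimately show thesis
    using continuous_deriv_imp_strict_deriv[of S "deriv S" 0 \<eta>] that \<open>0 < \<eta>\<close>
      saturating_has_derivative[OF S] by auto
qed

section \<open>Vectors and matrices\<close>

definition map_vec :: "('a \<Rightarrow> 'b) \<Rightarrow> 'a^'n \<Rightarrow> 'b^'n" where
  "map_vec f x = (\<chi> i. f (x $ i))"

definition permute_vec :: "('n \<Rightarrow> 'n) \<Rightarrow> 'a^'n \<Rightarrow> 'a^'n" where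
  "permute_vec \<rho> x = (\<chi> i. x $ \<rho> i)"

definition positive_vec :: "'a::{zero,ord}^'n \<Rightarrow> bool" where
  "positive_vec x \<longleftrightarrow> (\<forall>i. 0 < x $ i)"

definition matrix_automorphisms :: "'a^'n^'n \<Rightarrow> ('n \<Rightarrow> 'n) set" where
  "matrix_automorphisms A = {\<rho>. bij \<rho> \<and> (\<forall>i k. A $ \<rho> i $ \<rho> k = A $ i $ k)}"

lemma map_vec_nth [simp]: "map_vec f x $ i = f (x $ i)"
  by (simp add: map_vec_def)

lemma permute_vec_nth [simp]: "permute_vec \<rho> x $ i = x $ \<rho> i"
  by (simp add: permute_vec_def)

lemma saturating_map_vec_near_identity:
  assumes "saturating S" and "0 < \<eta>"
  obtains \<delta> where "0 < \<delta>"
    "\<And>x y :: real^'n. \<lbrakk>norm x < \<delta>; norm y < \<delta>\<rbrakk> \<Longrightarrow>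
      norm (map_vec S x - map_vec S y - (x - y)) \<le> \<eta> * norm (x - y)"
proof -
  obtain \<delta> where "0 < \<delta>"
    and near_identity: "\<And>a b. \<lbrakk>\<bar>a\<bar> < \<delta>; \<bar>b\<bar> < \<delta>\<rbrakk> \<Longrightarrow> \<bar>S a - S b - (a - b)\<bar> \<le> \<eta> * \<bar>a - b\<bar>"
    using saturating_near_identity[OF assms] by metis
  show thesis
  proof
    fix x y :: "real^'n" assume small: "norm x < \<delta>" "norm y < \<delta>"
    have "norm (map_vec S x - map_vec S y - (x - y)) \<le> norm (\<eta> *\<^sub>R (x - y))"
    proof (rule norm_le_componentwise_cart)
      fix i
      have "\<bar>x $ i\<bar> < \<delta>" "\<bar>y $ i\<bar> < \<delta>"
        using small component_le_norm_cart[of x i] component_le_norm_cart[of y i] by linarith+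
      then show "norm ((map_vec S x - map_vec S y - (x - y)) $ i) \<le> norm ((\<eta> *\<^sub>R (x - y)) $ i)"
        using near_identity \<open>0 < \<eta>\<close> by (simp add: abs_mult)
    qed
    then show "norm (map_vec S x - map_vec S y - (x - y)) \<le> \<eta> * norm (x - y)"
      using \<open>0 < \<eta>\<close> by simp
  qed fact
qed

lemma inner_permute_vec:
  fixes x y :: "'a::real_inner^'n"
  assumes "bij \<rho>"
  shows "permute_vec \<rho> x \<bullet> permute_vec \<rho> y = x \<bullet> y"
  using sum.reindex_bij_betw[OF assms, of "\<lambda>k. x $ k \<bullet> y $ k"] by (simp add: inner_vec_def)

lemma norm_permute_vec:
  fixes x :: "'a::real_inner^'n"
  assumes "bij \<rho>"
  shows "norm (permute_vec \<rho> x) = norm x"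
  by (simp add: norm_eq_sqrt_inner inner_permute_vec[OF assms])

lemma matrix_vector_mult_permute_vec:
  fixes A :: "'a::semiring_1^'n^'n"
  assumes "\<rho> \<in> matrix_automorphisms A"
  shows "A *v permute_vec \<rho> x = permute_vec \<rho> (A *v x)"
proof -
  have \<rho>: "bij \<rho>" "\<And>i k. A $ \<rho> i $ \<rho> k = A $ i $ k"
    using assms by (auto simp: matrix_automorphisms_def)
  have "(\<Sum>k\<in>UNIV. A $ i $ k * x $ \<rho> k) = (\<Sum>k\<in>UNIV. A $ \<rho> i $ k * x $ k)" for i
    using sum.reindex_bij_betw[OF \<rho>(1), of "\<lambda>k. A $ \<rho> i $ k * x $ k"] by (simp add: \<rho>(2))
  then show ?thesis
    by (simp add: matrix_vector_mult_def vec_eq_iff)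
qed

lemma subspace_eigenspace: "subspace (eigenspace A l)"
  by (auto simp: subspace_def eigenspace_def algebra_simps)

lemma permute_vec_eigenspace:
  assumes "\<rho> \<in> matrix_automorphisms A" "v \<in> eigenspace A l"
  shows "permute_vec \<rho> v \<in> eigenspace A l"
  using assms by (simp add: eigenspace_def matrix_vector_mult_permute_vec vec_eq_iff)

lemma permute_vec_simple_eigenvector:
  assumes \<rho>: "\<rho> \<in> matrix_automorphisms A" and v: "eigenspace A l = span {v}"
  shows "permute_vec \<rho> v = v \<or> permute_vec \<rho> v = - v"
proof (cases "v = 0")
  case False
  have "permute_vec \<rho> v \<in> span {v}"
    using permute_vec_eigenspace[OF \<rho>, of v l] by (simp add: v span_base)
  moreover have "norm (permute_vec \<rho> v) = norm v"
    using \<rho> by (intro norm_permute_vec) (simp add: matrix_automorphisms_def)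
  ultimately show ?thesis
    using False by (auto simp: span_singleton abs_if split: if_splits)
qed (simp add: vec_eq_iff)

lemma subspace_dim_1_eq_span:
  fixes V :: "'a::euclidean_space set"
  assumes "subspace V" "dim V = 1"
  obtains v where "V = span {v}"
proof -
  have "\<not> V \<subseteq> {0}" using \<open>dim V = 1\<close> dim_eq_0[of V] by simp
  then obtain v where "v \<in> V" "v \<noteq> 0" by blast
  then have "span {v} = span V"
    using \<open>dim V = 1\<close> by (intro dim_eq_span) auto
  then show thesis
    using that span_eq_iff[of V] \<open>subspace V\<close> by metis
qed

lemma agreement_imp_positive_vec:
  assumes "agreement x"
  shows "positive_vec x \<or> positive_vec (- x)"
  using assms unfolding agreement_def positive_vec_def
  by (metis linorder_neqE_linordered_idom neg_0_less_iff_less sgn_greater vector_uminus_component)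

section \<open>Positive fixed points of subhomogeneous maps\<close>

lemma positive_vec_largest_multiple_below:
  fixes x y :: "real^'n"
  assumes "positive_vec x" "positive_vec y"
  obtains t i where "0 < t" "t *\<^sub>R y \<le> x" "(t *\<^sub>R y) $ i = x $ i"
proof -
  have pos: "0 < x $ j" "0 < y $ j" for j
    using assms by (auto simp: positive_vec_def)
  define t where "t = Min (range (\<lambda>j. x $ j / y $ j))"
  have "t \<in> range (\<lambda>j. x $ j / y $ j)"
    unfolding t_def by (rule Min_in) auto
  then obtain i where touching: "t = x $ i / y $ i" by blast
  have "t \<le> x $ j / y $ j" for j
    unfolding t_def by (rule Min_le) auto
  then have "t *\<^sub>R y \<le> x"
    using pos by (simp add: less_eq_vec_def pos_le_divide_eq)
  moreover have "0 < t" "(t *\<^sub>R y) $ i = x $ i"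
    using pos[of i] by (simp_all add: touching)
  ultimately show thesis using that by blast
qed

lemma positive_fixed_point_ge:
  fixes G :: "real^'n \<Rightarrow> real^'n"
  assumes mono: "mono_on {0..} G" and "G x = x"
    and "positive_vec x" "positive_vec y"
    and subhomogeneous: "\<And>t i. \<lbrakk>0 < t; t < 1\<rbrakk> \<Longrightarrow> t * y $ i < G (t *\<^sub>R y) $ i"
  shows "y \<le> x"
proof -
  obtain t i where multiple: "0 < t" "t *\<^sub>R y \<le> x" "(t *\<^sub>R y) $ i = x $ i"
    using positive_vec_largest_multiple_below assms(3,4) by blast
  have "1 \<le> t"
  proof (rule ccontr)
    assume "\<not> 1 \<le> t"
    have "0 \<le> t *\<^sub>R y" "0 \<le> x"
      using multiple(1) assms(3,4) by (simp_all add: less_eq_vec_def positive_vec_def less_imp_le)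
    then have "G (t *\<^sub>R y) \<le> x"
      using mono_onD[OF mono _ _ multiple(2)] \<open>G x = x\<close> by simp
    moreover have "x $ i < G (t *\<^sub>R y) $ i"
      using subhomogeneous[of t i] multiple \<open>\<not> 1 \<le> t\<close> by simp
    ultimately show False by (auto simp: less_eq_vec_def not_less[symmetric])
  qed
  then have "y \<le> t *\<^sub>R y"
    using \<open>positive_vec y\<close> by (simp add: less_eq_vec_def positive_vec_def less_imp_le)
  then show ?thesis using multiple(2) by (rule order_trans)
qed

section \<open>Opinion networks\<close>

locale opinion_network =
  fixes d \<alpha> \<gamma> :: real and S :: "real \<Rightarrow> real" and A :: "real^'n^'n"
  assumes saturating_S: "saturating S" and diagonal_zero: "\<And>i. A $ i $ i = 0"
begin

abbreviation vector_field :: "real \<Rightarrow> real^'n \<Rightarrow> real^'n" where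
  "vector_field \<equiv> opinion_field d \<alpha> \<gamma> S A"

abbreviation is_equilibrium :: "real \<Rightarrow> real^'n \<Rightarrow> bool" where
  "is_equilibrium \<equiv> equilibrium d \<alpha> \<gamma> S A"

definition net_input :: "real^'n \<Rightarrow> real^'n" where
  "net_input x = \<alpha> *\<^sub>R x + \<gamma> *\<^sub>R (A *v x)"

definition linearization :: "real \<Rightarrow> real^'n \<Rightarrow> real^'n" where
  "linearization u x = u *\<^sub>R net_input x - d *\<^sub>R x"

lemma bounded_linear_net_input: "bounded_linear net_input"
  unfolding net_input_def by (intro bounded_linear_add bounded_linear_const_scaleR
      bounded_linear_ident matrix_vector_mul_bounded_linear)

lemma bounded_linear_linearization: "bounded_linear (linearization u)"
  unfolding linearization_def by (intro bounded_linear_sub bounded_linear_const_scaleR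
      bounded_linear_ident bounded_linear_net_input)

lemmas linear_net_input = bounded_linear.linear[OF bounded_linear_net_input]

lemma vector_field_eq: "vector_field u x = u *\<^sub>R map_vec S (net_input x) - d *\<^sub>R x"
proof -
  have "(\<Sum>k\<in>UNIV - {i}. A $ i $ k * x $ k) = (A *v x) $ i" for i
    by (simp add: matrix_vector_mult_def sum_diff1 diagonal_zero)
  then show ?thesis
    by (simp add: opinion_field_def net_input_def vec_eq_iff)
qed

lemma is_equilibrium_iff: "is_equilibrium u x \<longleftrightarrow> u *\<^sub>R map_vec S (net_input x) = d *\<^sub>R x"
  by (simp add: equilibrium_def vector_field_eq)

lemma is_equilibrium_uminus:
  assumes "is_equilibrium u x"
  shows "is_equilibrium u (- x)"
  using assms by (simp add: is_equilibrium_iff linear_neg[OF linear_net_input] vec_eq_iff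
      saturating_odd[OF saturating_S])

lemma is_equilibrium_permute_vec:
  assumes "\<rho> \<in> matrix_automorphisms A" "is_equilibrium u x"
  shows "is_equilibrium u (permute_vec \<rho> x)"
  using assms by (simp add: is_equilibrium_iff net_input_def vec_eq_iff
      matrix_vector_mult_permute_vec)

subsection \<open>Agreement equilibria\<close>

lemma mono_net_input:
  assumes "0 \<le> \<alpha>" "0 \<le> \<gamma>" "\<And>i k. 0 \<le> A $ i $ k"
  shows "mono net_input"
proof (rule monoI)
  fix x y :: "real^'n" assume "x \<le> y"
  then show "net_input x \<le> net_input y"
    using assms unfolding net_input_def less_eq_vec_def matrix_vector_mult_def
    by (auto intro!: add_mono mult_left_mono sum_mono)
qed

lemma positive_equilibrium_strictly_subhomogeneous:
  assumes "0 < d" "0 \<le> u" "is_equilibrium u y" "positive_vec y" "0 < t" "t < 1"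
  shows "t * (d * y $ i) < u * S (net_input (t *\<^sub>R y) $ i)"
proof -
  have eq: "u * S (net_input y $ i) = d * y $ i"
    using \<open>is_equilibrium u y\<close> by (simp add: is_equilibrium_iff vec_eq_iff)
  have "0 < u * S (net_input y $ i)"
    unfolding eq using \<open>0 < d\<close> \<open>positive_vec y\<close> by (simp add: positive_vec_def)
  then have "0 < u" "0 < S (net_input y $ i)"
    using \<open>0 \<le> u\<close> by (auto simp: zero_less_mult_iff)
  then have "t * S (net_input y $ i) < S (t * net_input y $ i)"
    using assms(5,6) saturating_S
    by (intro saturating_strictly_subhomogeneous) (auto simp: saturating_pos_iff)
  then have "u * (t * S (net_input y $ i)) < u * S (t * net_input y $ i)"
    using \<open>0 < u\<close> by simp
  then show ?thesis
    by (simp add: mult.left_commute[of u] eq linear_scale[OF linear_net_input])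
qed

lemma positive_equilibrium_unique:
  assumes nonneg: "0 \<le> \<alpha>" "0 \<le> \<gamma>" "\<And>i k. 0 \<le> A $ i $ k" and "0 < d" "0 \<le> u"
    and x: "is_equilibrium u x" "positive_vec x" and y: "is_equilibrium u y" "positive_vec y"
  shows "x = y"
proof -
  define G where "G z = (u / d) *\<^sub>R map_vec S (net_input z)" for z
  have fixed: "G z = z" if "is_equilibrium u z" for z
    using that \<open>0 < d\<close> by (simp add: G_def is_equilibrium_iff vec_eq_iff field_simps)
  have "mono G"
    unfolding G_def using \<open>0 < d\<close> \<open>0 \<le> u\<close> mono_net_input[OF nonneg]
      strict_mono_mono[OF saturating_strict_mono[OF saturating_S]]
    by (auto simp: mono_def less_eq_vec_def intro!: mult_left_mono divide_right_mono)
  then have mono: "mono_on {0..} G" by (simp add: mono_on_def mono_def)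
  have subhomogeneous: "t * z $ i < G (t *\<^sub>R z) $ i"
    if "is_equilibrium u z" "positive_vec z" "0 < t" "t < 1" for z t i
    using positive_equilibrium_strictly_subhomogeneous[OF \<open>0 < d\<close> \<open>0 \<le> u\<close> that, of i] \<open>0 < d\<close>
    by (simp add: G_def field_simps)
  have "y \<le> x"
    by (rule positive_fixed_point_ge[OF mono fixed[OF x(1)] x(2) y(2) subhomogeneous[OF y]])
  moreover have "x \<le> y"
    by (rule positive_fixed_point_ge[OF mono fixed[OF y(1)] y(2) x(2) subhomogeneous[OF x]])
  ultimately show ?thesis by simp
qed

lemma agreement_equilibrium_permute_vec_eq:
  assumes parameters: "0 \<le> \<alpha>" "0 \<le> \<gamma>" "\<And>i k. 0 \<le> A $ i $ k" "0 < d" "0 \<le> u"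
    and \<rho>: "\<rho> \<in> matrix_automorphisms A"
    and x: "is_equilibrium u x" "agreement x"
  shows "permute_vec \<rho> x = x"
proof -
  have positive: "permute_vec \<rho> z = z" if z: "is_equilibrium u z" "positive_vec z" for z
    using positive_equilibrium_unique[OF parameters is_equilibrium_permute_vec[OF \<rho> z(1)] _ z] z(2)
    by (simp add: positive_vec_def)
  from agreement_imp_positive_vec[OF x(2)] show ?thesis
  proof
    assume "positive_vec (- x)"
    then have "permute_vec \<rho> (- x) = - x"
      using is_equilibrium_uminus[OF x(1)] by (intro positive)
    then show ?thesis by (simp add: vec_eq_iff)
  qed (use positive x(1) in blast)
qed

subsection \<open>Equilibria near a simple bifurcation point\<close>

lemma norm_linearization_error_le:
  fixes x y :: "real^'n"
  defines "\<Delta> \<equiv> net_input (x - y)"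
  assumes remainder: "norm (map_vec S (net_input x) - map_vec S (net_input y) - \<Delta>) \<le> \<theta> * norm \<Delta>"
    and input_bound: "norm \<Delta> \<le> norm (x - y) * K"
    and u: "\<bar>u\<bar> \<le> U" "\<bar>u - u0\<bar> \<le> \<kappa>" and "0 \<le> \<theta>"
  shows "norm (vector_field u x - vector_field u y - linearization u0 (x - y))
    \<le> (U * \<theta> + \<kappa>) * (norm (x - y) * K)"
proof -
  let ?R = "map_vec S (net_input x) - map_vec S (net_input y) - \<Delta>"
  have "vector_field u x - vector_field u y - linearization u0 (x - y) = u *\<^sub>R ?R + (u - u0) *\<^sub>R \<Delta>"
    by (simp add: vector_field_eq linearization_def \<Delta>_def algebra_simps)
  also have "norm \<dots> \<le> \<bar>u\<bar> * norm ?R + \<bar>u - u0\<bar> * norm \<Delta>"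
    by (metis norm_scaleR norm_triangle_ineq)
  also have "\<dots> \<le> U * (\<theta> * norm \<Delta>) + \<kappa> * norm \<Delta>"
    using u remainder by (intro add_mono mult_mono) auto
  also have "\<dots> = (U * \<theta> + \<kappa>) * norm \<Delta>"
    by (simp add: algebra_simps)
  also have "\<dots> \<le> (U * \<theta> + \<kappa>) * (norm (x - y) * K)"
    using input_bound u \<open>0 \<le> \<theta>\<close> by (intro mult_left_mono) auto
  finally show ?thesis .
qed

lemma vector_field_strict_linearization:
  assumes "0 < \<eta>"
  obtains \<epsilon> where "0 < \<epsilon>"
    "\<And>x y u. \<lbrakk>dist (x, u) (0, u0) < \<epsilon>; dist (y, u) (0, u0) < \<epsilon>\<rbrakk> \<Longrightarrow>
      norm (vector_field u x - vector_field u y - linearization u0 (x - y)) \<le> \<eta> * norm (x - y)"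
proof -
  obtain K where "0 < K" and input_bound: "\<And>z. norm (net_input z) \<le> norm z * K"
    using bounded_linear.pos_bounded[OF bounded_linear_net_input] by blast
  define \<theta> where "\<theta> = \<eta> / (2 * K * (\<bar>u0\<bar> + 1))"
  have \<theta>: "0 < \<theta>" "((\<bar>u0\<bar> + 1) * \<theta> + \<eta> / (2 * K)) * K = \<eta>"
    using \<open>0 < \<eta>\<close> \<open>0 < K\<close> by (simp_all add: \<theta>_def divide_simps)
  obtain \<delta> where "0 < \<delta>" and
    near_identity: "\<And>x y :: real^'n. \<lbrakk>norm x < \<delta>; norm y < \<delta>\<rbrakk> \<Longrightarrow>
      norm (map_vec S x - map_vec S y - (x - y)) \<le> \<theta> * norm (x - y)"
    using saturating_map_vec_near_identity[OF saturating_S \<theta>(1)] by blast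
  define \<epsilon> where "\<epsilon> = min 1 (min (\<eta> / (2 * K)) (\<delta> / K))"
  have small_input: "norm (net_input z) < \<delta>" if "dist (z, u) (0, u0) < \<epsilon>" for z u
  proof -
    have "norm z < \<epsilon>" using that dist_fst_le[of "(z, u)" "(0, u0)"] by simp
    then have "norm z * K < \<delta>" using \<open>0 < K\<close> by (simp add: \<epsilon>_def field_simps)
    then show ?thesis using input_bound[of z] by linarith
  qed
  show thesis
  proof
    show "0 < \<epsilon>" using \<open>0 < \<eta>\<close> \<open>0 < K\<close> \<open>0 < \<delta>\<close> by (simp add: \<epsilon>_def)
    fix x y :: "real^'n" and u assume close: "dist (x, u) (0, u0) < \<epsilon>" "dist (y, u) (0, u0) < \<epsilon>"
    have "\<bar>u - u0\<bar> < \<epsilon>"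
      using close(1) dist_snd_le[of "(x, u)" "(0, u0)"] by (simp add: dist_real_def)
    then have u: "\<bar>u\<bar> \<le> \<bar>u0\<bar> + 1" "\<bar>u - u0\<bar> \<le> \<eta> / (2 * K)"
      unfolding \<epsilon>_def by linarith+
    have "norm (vector_field u x - vector_field u y - linearization u0 (x - y))
        \<le> ((\<bar>u0\<bar> + 1) * \<theta> + \<eta> / (2 * K)) * (norm (x - y) * K)"
      using near_identity[OF close[THEN small_input]] input_bound u \<theta>(1)
      by (intro norm_linearization_error_le)
        (auto simp: linear_diff[OF linear_net_input, symmetric])
    also have "\<dots> = \<eta> * norm (x - y)"
      using arg_cong[OF \<theta>(2), of "\<lambda>c. c * norm (x - y)"] by (simp add: mult_ac)
    finally show "norm (vector_field u x - vector_field u y - linearization u0 (x - y))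
        \<le> \<eta> * norm (x - y)" .
  qed
qed

lemma equilibrium_locally_unique:
  assumes "subspace W" and injective: "\<And>z. \<lbrakk>z \<in> W; linearization u0 z = 0\<rbrakk> \<Longrightarrow> z = 0"
  obtains \<epsilon> where "0 < \<epsilon>"
    "\<And>x y u. \<lbrakk>dist (x, u) (0, u0) < \<epsilon>; dist (y, u) (0, u0) < \<epsilon>; x - y \<in> W;
      is_equilibrium u x; is_equilibrium u y\<rbrakk> \<Longrightarrow> x = y"
proof -
  have "\<exists>e>0. \<forall>z\<in>W. e * norm z \<le> norm (linearization u0 z)"
    using \<open>subspace W\<close> injective
    by (intro injective_imp_isometric closed_subspace bounded_linear_linearization) auto
  then obtain e where "0 < e" and lower_bound: "\<And>z. z \<in> W \<Longrightarrow> e * norm z \<le> norm (linearization u0 z)"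
    by blast
  obtain \<epsilon> where "0 < \<epsilon>" and
    error: "\<And>x y u. \<lbrakk>dist (x, u) (0, u0) < \<epsilon>; dist (y, u) (0, u0) < \<epsilon>\<rbrakk> \<Longrightarrow>
      norm (vector_field u x - vector_field u y - linearization u0 (x - y)) \<le> e / 2 * norm (x - y)"
    using vector_field_strict_linearization[of "e / 2"] \<open>0 < e\<close> by (metis half_gt_zero)
  show thesis
  proof
    fix x y u
    assume close: "dist (x, u) (0, u0) < \<epsilon>" "dist (y, u) (0, u0) < \<epsilon>" and "x - y \<in> W"
      and "is_equilibrium u x" "is_equilibrium u y"
    then have "norm (linearization u0 (x - y)) \<le> e / 2 * norm (x - y)"
      using error[OF close] by (simp add: equilibrium_def)
    then have "e * norm (x - y) \<le> e / 2 * norm (x - y)"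
      using lower_bound[OF \<open>x - y \<in> W\<close>] by linarith
    then show "x = y" using \<open>0 < e\<close> by simp
  qed fact
qed

lemma linearization_eq_0_imp_eigenspace:
  assumes "d \<noteq> 0" "\<gamma> \<noteq> 0" and u0: "u0 = d / (\<alpha> + \<gamma> * l)" and z: "linearization u0 z = 0"
  shows "z \<in> eigenspace A l"
proof (cases "\<alpha> + \<gamma> * l = 0")
  case True
  \<comment> \<open>Division by zero makes \<open>u0 = 0\<close> here.\<close>
  then have "z = 0" using u0 z \<open>d \<noteq> 0\<close> by (simp add: linearization_def)
  then show ?thesis by (simp add: eigenspace_def)
next
  case False
  then have "u0 \<noteq> 0" "d = u0 * (\<alpha> + \<gamma> * l)"
    using u0 \<open>d \<noteq> 0\<close> by simp_all
  have "u0 *\<^sub>R net_input z = d *\<^sub>R z"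
    using z by (simp add: linearization_def)
  also have "\<dots> = u0 *\<^sub>R (\<alpha> + \<gamma> * l) *\<^sub>R z"
    unfolding \<open>d = u0 * (\<alpha> + \<gamma> * l)\<close> by simp
  finally have "net_input z = (\<alpha> + \<gamma> * l) *\<^sub>R z"
    using \<open>u0 \<noteq> 0\<close> by (simp del: scaleR_scaleR)
  then have "\<gamma> *\<^sub>R (A *v z) = \<gamma> *\<^sub>R l *\<^sub>R z"
    by (simp add: net_input_def scaleR_add_left)
  then show ?thesis using \<open>\<gamma> \<noteq> 0\<close> by (simp add: eigenspace_def del: scaleR_scaleR)
qed

lemma simple_bifurcation_locally_unique:
  assumes "d \<noteq> 0" "\<gamma> \<noteq> 0" "u0 = d / (\<alpha> + \<gamma> * l)" and v: "eigenspace A l = span {v}"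
  obtains \<epsilon> where "0 < \<epsilon>"
    "\<And>x y u. \<lbrakk>dist (x, u) (0, u0) < \<epsilon>; dist (y, u) (0, u0) < \<epsilon>; v \<bullet> x = v \<bullet> y;
      is_equilibrium u x; is_equilibrium u y\<rbrakk> \<Longrightarrow> x = y"
proof (rule equilibrium_locally_unique)
  show "subspace {z. v \<bullet> z = 0}" by (rule subspace_hyperplane)
next
  fix z assume "z \<in> {z. v \<bullet> z = 0}" "linearization u0 z = 0"
  moreover from linearization_eq_0_imp_eigenspace[OF assms(1-3) this(2)]
  obtain c where "z = c *\<^sub>R v" by (auto simp: v span_singleton)
  ultimately show "z = 0" by auto
qed (use that in \<open>simp add: inner_diff_right\<close>)

lemma simple_bifurcation_permute_vec_eq:
  assumes "d \<noteq> 0" "\<gamma> \<noteq> 0" "u0 = d / (\<alpha> + \<gamma> * l)" "dim (eigenspace A l) = 1"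
  obtains \<epsilon> where "0 < \<epsilon>"
    "\<And>\<rho> x u. \<lbrakk>\<rho> \<in> matrix_automorphisms A; dist (x, u) (0, u0) < \<epsilon>; is_equilibrium u x\<rbrakk> \<Longrightarrow>
      permute_vec \<rho> x = x \<or> permute_vec \<rho> x = - x"
proof -
  obtain v where v: "eigenspace A l = span {v}"
    using subspace_dim_1_eq_span subspace_eigenspace \<open>dim (eigenspace A l) = 1\<close> by blast
  obtain \<epsilon> where "0 < \<epsilon>" and
    unique: "\<And>x y u. \<lbrakk>dist (x, u) (0, u0) < \<epsilon>; dist (y, u) (0, u0) < \<epsilon>; v \<bullet> x = v \<bullet> y;
      is_equilibrium u x; is_equilibrium u y\<rbrakk> \<Longrightarrow> x = y"
    using simple_bifurcation_locally_unique[OF assms(1-3) v] by metis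
  show thesis
  proof
    fix \<rho> x u
    assume \<rho>: "\<rho> \<in> matrix_automorphisms A" and close: "dist (x, u) (0, u0) < \<epsilon>"
      and x: "is_equilibrium u x"
    have "bij \<rho>" using \<rho> by (simp add: matrix_automorphisms_def)
    have close_permuted: "dist (permute_vec \<rho> x, u) (0, u0) < \<epsilon>"
      and close_uminus: "dist (- x, u) (0, u0) < \<epsilon>"
      using close by (simp_all add: dist_Pair_Pair norm_permute_vec[OF \<open>bij \<rho>\<close>])
    have permuted: "is_equilibrium u (permute_vec \<rho> x)"
      using \<rho> x by (rule is_equilibrium_permute_vec)
    from permute_vec_simple_eigenvector[OF \<rho> v]
    show "permute_vec \<rho> x = x \<or> permute_vec \<rho> x = - x"
    proof
      assume "permute_vec \<rho> v = v"
      then have "v \<bullet> permute_vec \<rho> x = v \<bullet> x"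
        using inner_permute_vec[OF \<open>bij \<rho>\<close>, of v x] by simp
      then have "permute_vec \<rho> x = x"
        using unique[OF close_permuted close _ permuted x] by simp
      then show ?thesis ..
    next
      assume "permute_vec \<rho> v = - v"
      then have "v \<bullet> permute_vec \<rho> x = - (v \<bullet> x)"
        using inner_permute_vec[OF \<open>bij \<rho>\<close>, of v x] by simp
      then have "permute_vec \<rho> x = - x"
        using unique[OF close_permuted close_uminus _ permuted is_equilibrium_uminus[OF x]] by simp
      then show ?thesis ..
    qed
  qed fact
qed

end

section \<open>Opinion dynamics on a graph\<close>

lemma opinion_network_adjacency:
  assumes "saturating S" "simple_graph E"
  shows "opinion_network S (adjacency E)"
  using assms by unfold_locales (simp_all add: adjacency_def simple_graph_def)

lemma matrix_automorphisms_adjacency: "matrix_automorphisms (adjacency E) = automorphisms E"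
  by (auto simp: matrix_automorphisms_def automorphisms_def adjacency_def)

lemma same_orbitE:
  assumes "same_orbit E i k"
  obtains \<rho> where "\<rho> \<in> matrix_automorphisms (adjacency E)" "\<And>x. x $ k = permute_vec \<rho> x $ i"
  using assms by (auto simp: same_orbit_def matrix_automorphisms_adjacency)

lemma agreement_equilibrium_eq_on_orbit:
  assumes "saturating S" "simple_graph E" "0 < d" "0 \<le> \<alpha>" "0 \<le> \<gamma>" "0 \<le> u"
    and "equilibrium d \<alpha> \<gamma> S (adjacency E) u x" "agreement x" "same_orbit E i k"
  shows "x $ i = x $ k"
proof -
  obtain \<rho> where \<rho>: "\<rho> \<in> matrix_automorphisms (adjacency E)" "x $ k = permute_vec \<rho> x $ i"
    using \<open>same_orbit E i k\<close> by (rule same_orbitE) blast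
  have "permute_vec \<rho> x = x"
    using opinion_network_adjacency[OF assms(1,2)] assms \<rho>(1)
    by (intro opinion_network.agreement_equilibrium_permute_vec_eq) (simp_all add: adjacency_def)
  then show ?thesis using \<rho>(2) by simp
qed

lemma simple_bifurcation_abs_eq_on_orbit:
  fixes E :: "'n::finite \<Rightarrow> 'n \<Rightarrow> bool"
  assumes "saturating S" "simple_graph E" "d \<noteq> 0" "\<gamma> \<noteq> 0" "u0 = d / (\<alpha> + \<gamma> * l)"
    and "eigen_multiplicity (adjacency E) l = 1"
  obtains \<epsilon> where "0 < \<epsilon>"
    "\<And>x u i k. \<lbrakk>dist (x, u) (0, u0) < \<epsilon>; equilibrium d \<alpha> \<gamma> S (adjacency E) u x; same_orbit E i k\<rbrakk> \<Longrightarrow>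
      \<bar>x $ i\<bar> = \<bar>x $ k\<bar>"
proof -
  obtain \<epsilon> where "0 < \<epsilon>" and
    plus_minus: "\<And>\<rho> x u. \<lbrakk>\<rho> \<in> matrix_automorphisms (adjacency E); dist (x, u) (0, u0) < \<epsilon>;
      equilibrium d \<alpha> \<gamma> S (adjacency E) u x\<rbrakk> \<Longrightarrow> permute_vec \<rho> x = x \<or> permute_vec \<rho> x = - x"
    using opinion_network.simple_bifurcation_permute_vec_eq opinion_network_adjacency[OF assms(1,2)]
      assms(3-6) unfolding eigen_multiplicity_def by metis
  show thesis
  proof
    fix x :: "real^'n" and u i k
    assume x: "dist (x, u) (0, u0) < \<epsilon>" "equilibrium d \<alpha> \<gamma> S (adjacency E) u x"
      and "same_orbit E i k"
    obtain \<rho> where \<rho>: "\<rho> \<in> matrix_automorphisms (adjacency E)" "x $ k = permute_vec \<rho> x $ i"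
      using \<open>same_orbit E i k\<close> by (rule same_orbitE) blast
    show "\<bar>x $ i\<bar> = \<bar>x $ k\<bar>"
      using plus_minus[OF \<rho>(1) x] \<rho>(2) by (metis abs_minus_cancel vector_uminus_component)
  qed fact
qed

lemma emerging_branch_equilibrium:
  assumes "emerging_branch d \<alpha> \<gamma> S A u0 W p" "s \<in> {0<..1}" "p s = (x, u)"
  shows "0 \<le> u" "equilibrium d \<alpha> \<gamma> S A u x"
proof -
  have "0 \<le> snd (p s)" "equilibrium d \<alpha> \<gamma> S A (snd (p s)) (fst (p s))"
    using assms(1,2) by (simp_all add: emerging_branch_def)
  then show "0 \<le> u" "equilibrium d \<alpha> \<gamma> S A u x"
    by (simp_all add: assms(3))
qed

theorem theorem6:
  fixes E :: "'n::finite \<Rightarrow> 'n \<Rightarrow> bool"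
    and S :: "real \<Rightarrow> real"
    and d \<alpha> \<gamma> :: real
  assumes "CARD('n) \<ge> 2"
    and "simple_graph E" and "connected_graph E"
    and "saturating S"
    and "d > 0" and "\<alpha> \<ge> 0"
  shows
    "(\<gamma> > 0 \<longrightarrow>
       (let A = adjacency E; l = lambda_max A; ua = d / (\<alpha> + \<gamma> * l) in
        \<exists>\<epsilon>>0. \<forall>p. emerging_branch d \<alpha> \<gamma> S A ua (eigenspace A l) p \<longrightarrow>
          (\<forall>s\<in>{0<..1}. \<forall>x u. p s = (x, u) \<and> dist (x, u) (0, ua) < \<epsilon> \<and> agreement x \<longrightarrow>
             (\<forall>i k. same_orbit E i k \<longrightarrow> x $ i = x $ k)))) \<and>
     (\<gamma> < 0 \<and> eigen_multiplicity (adjacency E) (lambda_min (adjacency E)) = 1 \<longrightarrow>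
       (let A = adjacency E; l = lambda_min A; ud = d / (\<alpha> + \<gamma> * l) in
        \<exists>\<epsilon>>0. \<forall>p. emerging_branch d \<alpha> \<gamma> S A ud (eigenspace A l) p \<longrightarrow>
          (\<forall>s\<in>{0<..1}. \<forall>x u. p s = (x, u) \<and> dist (x, u) (0, ud) < \<epsilon> \<and> disagreement x \<longrightarrow>
             (\<forall>i k. same_orbit E i k \<longrightarrow> \<bar>x $ i\<bar> = \<bar>x $ k\<bar>))))"
proof (intro conjI impI)
  let "(_ \<longrightarrow> ?agreement_claim) \<and> (_ \<longrightarrow> ?disagreement_claim)" = ?thesis
  {
    assume "\<gamma> > 0"
    have "x $ i = x $ k"
      if "emerging_branch d \<alpha> \<gamma> S (adjacency E) u0 W p" "s \<in> {0<..1}" "p s = (x, u)"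
        "agreement x" "same_orbit E i k" for u0 W p s x u i k
      using agreement_equilibrium_eq_on_orbit[of S E d \<alpha> \<gamma> u x i k]
        emerging_branch_equilibrium[OF that(1-3)] that assms \<open>\<gamma> > 0\<close> by simp
    then show ?agreement_claim
      unfolding Let_def by (intro exI[of _ 1]) fastforce
  }
  let ?l = "lambda_min (adjacency E)"
  assume "\<gamma> < 0 \<and> eigen_multiplicity (adjacency E) ?l = 1"
  then obtain \<epsilon> where "0 < \<epsilon>"
    "\<And>x u i k. \<lbrakk>dist (x, u) (0, d / (\<alpha> + \<gamma> * ?l)) < \<epsilon>; equilibrium d \<alpha> \<gamma> S (adjacency E) u x;
      same_orbit E i k\<rbrakk> \<Longrightarrow> \<bar>x $ i\<bar> = \<bar>x $ k\<bar>"
    using simple_bifurcation_abs_eq_on_orbit[of S E d \<gamma> _ \<alpha> ?l] assms by (metis less_irrefl)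
  then show ?disagreement_claim
    unfolding Let_def using emerging_branch_equilibrium(2) by blast
qed

end
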